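(* Let $0<r\le\frac23$ and $0<\alpha\le\frac12$. Let $a:\mathbb{Z}^n\to\mathbb{C}$ satisfy $|a(\xi)|\le C\langle\xi\rangle^m$ for all $\xi\in\mathbb{Z}^n$. Assume $1<p_1\le2$, $q_1=(\alpha+\frac1{p_1'})^{-1}$, and $m<-\frac nr-\alpha n$. Then the Fourier multiplier $T_a$ is $r$-nuclear on $B^w_{p_1,q_1}(\mathbb{T}^n)$ for every $w\in\mathbb{R}$, and $\mathrm{Tr}(T_a)=\sum_{\xi\in\mathbb{Z}^n}a(\xi)=\sum_n\lambda_n(T_a)$, where $(\lambda_n(T_a))$ is the sequence of eigenvalues of $T_a$ with multiplicities taken into account.
   Context: $\widehat f(\xi)=\int_{\mathbb{T}^n}e^{-i2\pi x\cdot\xi}f(x)dx$, $\langle\xi\rangle=(1+|\xi|^2)^{1/2}$. The Fourier multiplier with symbol $a$ is $T_au(x)=\sum_{\xi\in\mathbb{Z}^n}e^{i2\pi x\cdot\xi}a(\xi)\widehat u(\xi)$. Periodic Besov spaces: $\|f\|_{B^w_{p,q}}=\big(\sum_{m\ge0}2^{mwq}\|\sum_{2^m\le|\xi|<2^{m+1}}e^{i2\pi x\cdot\xi}\widehat f(\xi)\|^q_{L^p(\mathbb{T}^n)}\big)^{1/q}$. $p'$ is the conjugate exponent. $T:E\to E$ is $r$-nuclear if $T=\sum_ne'_n(\cdot)y_n$ with $\sum_n\|e'_n\|^r_{E'}\|y_n\|^r_E<\infty$; its nuclear trace is $\sum_ne'_n(y_n)$.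
   Formalization: The Besov norm's m=0 block is taken over |ξ|<2 instead of 1≤|ξ|<2, so that ξ=0 is included; with the printed definition the norm is only a seminorm and Tr(T_a)=Σa(ξ) fails when a is supported at ξ=0. *)

theory Defs
  imports "HOL-Analysis.Analysis"
begin

text \<open>Frequencies xi in Z^n are modelled as int^'n (the dimension n is CARD('n)),
points of the torus T^n = [0,1]^n as real^'n. A periodic distribution f is
identified with its Fourier coefficient function (hat f) :: int^'n => complex;
all operators below act on these coefficient functions.\<close>

definition zn_norm :: "int^'n::finite \<Rightarrow> real" where
  "zn_norm \<xi> = sqrt (\<Sum>i\<in>UNIV. (real_of_int (\<xi>$i))^2)"

definition jbr :: "int^'n::finite \<Rightarrow> real" where
  "jbr \<xi> = sqrt (1 + (zn_norm \<xi>)^2)"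

definition pairing :: "real^'n::finite \<Rightarrow> int^'n \<Rightarrow> real" where
  "pairing x \<xi> = (\<Sum>i\<in>UNIV. x$i * real_of_int (\<xi>$i))"

definition dyadic :: "nat \<Rightarrow> (int^'n::finite) set" where
  "dyadic k = (if k = 0 then {\<xi>. zn_norm \<xi> < 2}
               else {\<xi>. 2^k \<le> zn_norm \<xi> \<and> zn_norm \<xi> < 2^(k+1)})"

definition block :: "(int^'n::finite \<Rightarrow> complex) \<Rightarrow> nat \<Rightarrow> real^'n \<Rightarrow> complex" where
  "block c k x = (\<Sum>\<xi>\<in>dyadic k. exp (\<i> * complex_of_real (2 * pi * pairing x \<xi>)) * c \<xi>)"

definition Lp_norm_torus :: "real \<Rightarrow> (real^'n::finite \<Rightarrow> complex) \<Rightarrow> real" where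
  "Lp_norm_torus p g = (integral (cbox 0 One) (\<lambda>x. cmod (g x) powr p)) powr (1/p)"

definition besov_term :: "real \<Rightarrow> real \<Rightarrow> real \<Rightarrow> (int^'n::finite \<Rightarrow> complex) \<Rightarrow> nat \<Rightarrow> real" where
  "besov_term w p q c k = 2 powr (real k * w * q) * (Lp_norm_torus p (block c k)) powr q"

definition besov_space :: "real \<Rightarrow> real \<Rightarrow> real \<Rightarrow> (int^'n::finite \<Rightarrow> complex) set" where
  "besov_space w p q = {c. summable (besov_term w p q c)}"

definition besov_norm :: "real \<Rightarrow> real \<Rightarrow> real \<Rightarrow> (int^'n::finite \<Rightarrow> complex) \<Rightarrow> real" where
  "besov_norm w p q c = (suminf (besov_term w p q c)) powr (1/q)"

definition besov_dual :: "real \<Rightarrow> real \<Rightarrow> real \<Rightarrow> ((int^'n::finite \<Rightarrow> complex) \<Rightarrow> complex) \<Rightarrow> bool" where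
  "besov_dual w p q \<phi> \<longleftrightarrow>
     (\<forall>c\<in>besov_space w p q. \<forall>d\<in>besov_space w p q. \<phi> (\<lambda>\<xi>. c \<xi> + d \<xi>) = \<phi> c + \<phi> d) \<and>
     (\<forall>c\<in>besov_space w p q. \<forall>z. \<phi> (\<lambda>\<xi>. z * c \<xi>) = z * \<phi> c) \<and>
     (\<exists>K. \<forall>c\<in>besov_space w p q. cmod (\<phi> c) \<le> K * besov_norm w p q c)"

definition dual_norm :: "real \<Rightarrow> real \<Rightarrow> real \<Rightarrow> ((int^'n::finite \<Rightarrow> complex) \<Rightarrow> complex) \<Rightarrow> real" where
  "dual_norm w p q \<phi> = Inf {K. 0 \<le> K \<and> (\<forall>c\<in>besov_space w p q. cmod (\<phi> c) \<le> K * besov_norm w p q c)}"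

definition nuclear_rep ::
  "real \<Rightarrow> real \<Rightarrow> real \<Rightarrow> real \<Rightarrow> ((int^'n::finite \<Rightarrow> complex) \<Rightarrow> (int^'n \<Rightarrow> complex))
   \<Rightarrow> (nat \<Rightarrow> (int^'n \<Rightarrow> complex) \<Rightarrow> complex) \<Rightarrow> (nat \<Rightarrow> int^'n \<Rightarrow> complex) \<Rightarrow> bool" where
  "nuclear_rep w p q r T \<phi> y \<longleftrightarrow>
     (\<forall>k. besov_dual w p q (\<phi> k) \<and> y k \<in> besov_space w p q) \<and>
     summable (\<lambda>k. (dual_norm w p q (\<phi> k)) powr r * (besov_norm w p q (y k)) powr r) \<and>
     (\<forall>c\<in>besov_space w p q. T c \<in> besov_space w p q \<and>
        (\<lambda>N. besov_norm w p q (\<lambda>\<xi>. T c \<xi> - (\<Sum>k<N. \<phi> k c * y k \<xi>))) \<longlonglongrightarrow> 0)"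

definition r_nuclear :: "real \<Rightarrow> real \<Rightarrow> real \<Rightarrow> real \<Rightarrow> ((int^'n::finite \<Rightarrow> complex) \<Rightarrow> (int^'n \<Rightarrow> complex)) \<Rightarrow> bool" where
  "r_nuclear w p q r T \<longleftrightarrow> (\<exists>\<phi> y. nuclear_rep w p q r T \<phi> y)"

text \<open>Fourier multiplier T_a on the Fourier side: (T_a u)^(xi) = a(xi) u^(xi).\<close>
definition multiplier :: "(int^'n::finite \<Rightarrow> complex) \<Rightarrow> (int^'n \<Rightarrow> complex) \<Rightarrow> (int^'n \<Rightarrow> complex)" where
  "multiplier a c = (\<lambda>\<xi>. a \<xi> * c \<xi>)"

definition is_eigenvalue :: "real \<Rightarrow> real \<Rightarrow> real \<Rightarrow> ((int^'n::finite \<Rightarrow> complex) \<Rightarrow> (int^'n \<Rightarrow> complex)) \<Rightarrow> complex \<Rightarrow> bool" where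
  "is_eigenvalue w p q T \<mu> \<longleftrightarrow>
     (\<exists>c\<in>besov_space w p q. c \<noteq> (\<lambda>_. 0) \<and> T c = (\<lambda>\<xi>. \<mu> * c \<xi>))"

definition gen_eigenspace :: "real \<Rightarrow> real \<Rightarrow> real \<Rightarrow> ((int^'n::finite \<Rightarrow> complex) \<Rightarrow> (int^'n \<Rightarrow> complex)) \<Rightarrow> complex \<Rightarrow> (int^'n \<Rightarrow> complex) set" where
  "gen_eigenspace w p q T \<mu> =
     {c\<in>besov_space w p q. \<exists>k. ((\<lambda>d. (\<lambda>\<xi>. T d \<xi> - \<mu> * d \<xi>)) ^^ k) c = (\<lambda>_. 0)}"

definition lin_indep :: "(int^'n::finite \<Rightarrow> complex) set \<Rightarrow> bool" where
  "lin_indep S \<longleftrightarrow> (\<forall>u. (\<lambda>\<xi>. \<Sum>s\<in>S. u s * s \<xi>) = (\<lambda>_. 0) \<longrightarrow> (\<forall>s\<in>S. u s = 0))"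

definition fin_dim_gen_eig :: "real \<Rightarrow> real \<Rightarrow> real \<Rightarrow> ((int^'n::finite \<Rightarrow> complex) \<Rightarrow> (int^'n \<Rightarrow> complex)) \<Rightarrow> complex \<Rightarrow> bool" where
  "fin_dim_gen_eig w p q T \<mu> \<longleftrightarrow>
     (\<exists>N. \<forall>S. finite S \<and> S \<subseteq> gen_eigenspace w p q T \<mu> \<and> lin_indep S \<longrightarrow> card S \<le> N)"

definition alg_mult :: "real \<Rightarrow> real \<Rightarrow> real \<Rightarrow> ((int^'n::finite \<Rightarrow> complex) \<Rightarrow> (int^'n \<Rightarrow> complex)) \<Rightarrow> complex \<Rightarrow> nat" where
  "alg_mult w p q T \<mu> =
     Sup {card S | S. finite S \<and> S \<subseteq> gen_eigenspace w p q T \<mu> \<and> lin_indep S}"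

end

theory Submission
  imports Defs "HOL-Library.Function_Algebras"
begin

text \<open>On Fourier coefficients the multiplier is diagonal, so it is the sum over \<open>\<xi>\<close> of the rank one
  operators \<open>c \<mapsto> a \<xi> * c \<xi>\<close> times the unit vector at \<open>\<xi>\<close>. A coefficient of a block is bounded by the
  \<open>L\<^sup>p\<close> norm of the block (orthogonality of characters and Jensen), so this rank one operator has
  norm at most \<open>\<bar>a \<xi>\<bar>\<close>, and the \<open>r\<close>-th powers are summable because \<open>m * r < -n\<close>. The trace does not
  depend on the representation since the dyadic truncations are finite rank contractions tending
  strongly to the identity: they reduce the trace to the finite sums of \<open>a\<close> over \<open>level \<xi> < N\<close>.
  Finally, the generalised eigenspace of \<open>\<mu> \<noteq> 0\<close> consists of the functions supported on the finite
  set where \<open>a = \<mu>\<close>.\<close>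

section \<open>Dyadic levels and characters of the torus\<close>

lemma abs_component_le_zn_norm: "\<bar>real_of_int (\<xi> $ i)\<bar> \<le> zn_norm \<xi>"
proof -
  have "(real_of_int (\<xi> $ i))\<^sup>2 \<le> (\<Sum>i\<in>UNIV. (real_of_int (\<xi> $ i))\<^sup>2)"
    by (rule member_le_sum) auto
  then show ?thesis
    unfolding zn_norm_def using real_le_rsqrt by fastforce
qed

lemma finite_zn_norm_less: "finite {\<xi> :: int^'n::finite. zn_norm \<xi> < R}"
proof -
  let ?A = "PiE (UNIV :: 'n set) (\<lambda>_. {-\<lceil>\<bar>R\<bar>\<rceil>..\<lceil>\<bar>R\<bar>\<rceil>})"
  have "finite ((\<lambda>f. \<chi> i. f i) ` ?A :: (int^'n) set)"
    by (intro finite_imageI finite_PiE) auto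
  moreover have "{\<xi> :: int^'n. zn_norm \<xi> < R} \<subseteq> (\<lambda>f. \<chi> i. f i) ` ?A"
  proof
    fix \<xi> :: "int^'n" assume "\<xi> \<in> {\<xi>. zn_norm \<xi> < R}"
    then have "\<bar>real_of_int (\<xi> $ i)\<bar> \<le> \<bar>R\<bar>" for i
      using abs_component_le_zn_norm[of \<xi> i] by simp
    then have "\<bar>\<xi> $ i\<bar> \<le> \<lceil>\<bar>R\<bar>\<rceil>" for i
      by (metis ceiling_mono ceiling_of_int of_int_abs)
    then have "(\<lambda>i. \<xi> $ i) \<in> ?A"
      by (auto simp: abs_le_iff minus_le_iff)
    then show "\<xi> \<in> (\<lambda>f. \<chi> i. f i) ` ?A"
      by (rule rev_image_eqI) simp
  qed
  ultimately show ?thesis by (rule finite_subset[rotated])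
qed

definition level :: "int^'n::finite \<Rightarrow> nat" where
  "level \<xi> = (LEAST k. zn_norm \<xi> < 2 ^ (k + 1))"

lemma mem_dyadic_iff: "\<xi> \<in> dyadic k \<longleftrightarrow> level \<xi> = k"
proof -
  let ?P = "\<lambda>k. zn_norm \<xi> < (2::real) ^ (k + 1)"
  obtain j where j: "zn_norm \<xi> < 2 ^ j"
    using real_arch_pow[of 2 "zn_norm \<xi>"] by auto
  then have "?P j" by (rule less_le_trans) simp
  then have ex: "?P (level \<xi>)" unfolding level_def by (rule LeastI[of ?P])
  have least: "level \<xi> \<le> i" if "?P i" for i
    unfolding level_def by (rule Least_le[of ?P, OF that])
  have lower: "2 ^ level \<xi> \<le> zn_norm \<xi>" if pos: "level \<xi> \<noteq> 0"
  proof -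
    obtain i where i: "level \<xi> = Suc i" using pos not0_implies_Suc by blast
    then have "\<not> ?P i" using least[of i] by auto
    then show ?thesis using i by (simp add: not_less)
  qed
  have le: "level \<xi> \<le> k" if "\<xi> \<in> dyadic k"
    using that by (intro least) (auto simp: dyadic_def split: if_splits)
  show ?thesis
  proof
    assume k: "\<xi> \<in> dyadic k"
    have "k \<le> level \<xi>"
    proof (rule ccontr)
      assume "\<not> k \<le> level \<xi>"
      then have "level \<xi> + 1 \<le> k" "k \<noteq> 0" by auto
      then have "(2::real) ^ (level \<xi> + 1) \<le> 2 ^ k" by (intro power_increasing) auto
      with ex k \<open>k \<noteq> 0\<close> show False by (auto simp: dyadic_def)
    qed
    with le[OF k] show "level \<xi> = k" by simp
  next
    assume "level \<xi> = k"
    then show "\<xi> \<in> dyadic k" using ex lower by (auto simp: dyadic_def)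
  qed
qed

lemma finite_dyadic: "finite (dyadic k)"
  by (rule finite_subset[OF _ finite_zn_norm_less[of "2 ^ (k + 1)"]])
    (auto simp: dyadic_def split: if_splits)

definition char_torus :: "int^'n::finite \<Rightarrow> real^'n \<Rightarrow> complex" where
  "char_torus \<xi> x = exp (\<i> * complex_of_real (2 * pi * pairing x \<xi>))"

lemma block_char: "block c k x = (\<Sum>\<xi>\<in>dyadic k. char_torus \<xi> x * c \<xi>)"
  by (simp add: block_def char_torus_def)

lemma norm_char_torus [simp]: "cmod (char_torus \<xi> x) = 1"
  unfolding char_torus_def by (metis norm_exp_i_times)

lemma continuous_on_pairing [continuous_intros]: "continuous_on S (\<lambda>x. pairing x \<xi>)"
  unfolding pairing_def by (intro continuous_intros)

lemma continuous_on_char_torus [continuous_intros]: "continuous_on S (char_torus \<xi>)"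
  unfolding char_torus_def by (intro continuous_intros)

lemma continuous_on_block [continuous_intros]: "continuous_on S (block c k)"
  unfolding block_char[abs_def] by (intro continuous_intros)

lemma pairing_add_axis: "pairing (x + axis i t) \<xi> = pairing x \<xi> + t * real_of_int (\<xi> $ i)"
proof -
  have "(\<Sum>j\<in>UNIV. axis i t $ j * real_of_int (\<xi> $ j)) = (\<Sum>j\<in>UNIV. if j = i then t * real_of_int (\<xi> $ j) else 0)"
    by (intro sum.cong) (auto simp: axis_def)
  then show ?thesis by (simp add: pairing_def algebra_simps sum.distrib)
qed

lemma char_torus_add_axis:
  "char_torus \<xi> (x + axis i t) = char_torus \<xi> x * exp (\<i> * complex_of_real (2 * pi * t * \<xi> $ i))"
  by (simp add: char_torus_def pairing_add_axis distrib_left distrib_right mult_ac flip: exp_add)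

lemma char_torus_zero [simp]: "char_torus 0 x = 1"
  by (simp add: char_torus_def pairing_def)

lemma char_torus_mult_cnj: "char_torus \<xi> x * cnj (char_torus \<eta> x) = char_torus (\<xi> - \<eta>) x"
  by (simp add: char_torus_def pairing_def exp_cnj algebra_simps sum_subtractf flip: exp_add)

lemma One_vec: "(One :: real^'n) = 1"
proof -
  have "(One :: real^'n) $ i = 1" for i
    unfolding cart_eq_inner_axis by (rule inner_sum_Basis) (simp add: axis_in_Basis_iff)
  then show ?thesis by (simp add: vec_eq_iff)
qed

lemma has_integral_translate_cbox:
  fixes f :: "'a::euclidean_space \<Rightarrow> 'b::real_normed_vector"
  assumes "(f has_integral I) (cbox a b)"
  shows "((\<lambda>x. f (x + c)) has_integral I) (cbox (a - c) (b - c))"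
  using has_integral_affinity[OF assms, of 1 c] cbox_shift''[of c a b] by simp

text \<open>Shifting the cube by half a wavelength in a coordinate where the frequency does not vanish
  flips the sign of the character, while periodicity lets the protruding slab be moved back.\<close>

lemma integral_char_torus_nonzero:
  fixes \<xi> :: "int^'n::finite"
  assumes "\<xi> \<noteq> 0"
  shows "integral (cbox 0 One) (char_torus \<xi>) = 0"
proof -
  obtain i where i: "\<xi> $ i \<noteq> 0" using assms by (auto simp: vec_eq_iff)
  define t where "t = 1 / (2 * \<bar>real_of_int (\<xi> $ i)\<bar>)"
  have "1 \<le> \<bar>real_of_int (\<xi> $ i)\<bar>" using i by (metis abs_ge_zero int_one_le_iff_zero_less of_int_1 of_int_abs of_int_le_iff zero_less_abs_iff)
  then have t: "0 < t" "t < 1" by (auto simp: t_def field_simps)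
  let ?g = "char_torus \<xi>"
  let ?B = "cbox 0 One :: (real^'n) set"
  have sh1: "?g (x + axis i (- t)) = - ?g x" for x
  proof (cases "\<xi> $ i > 0")
    case True
    then have *: "2 * pi * (- t) * \<xi> $ i = - pi" by (simp add: t_def)
    show ?thesis unfolding char_torus_add_axis * by (simp add: exp_minus)
  next
    case False
    then have *: "2 * pi * (- t) * \<xi> $ i = pi" using i by (simp add: t_def)
    show ?thesis unfolding char_torus_add_axis * by simp
  qed
  have per: "?g (x + axis i 1) = ?g x" for x
  proof -
    have "exp (\<i> * complex_of_real (2 * pi * 1 * \<xi> $ i)) = 1"
      by (subst exp_eq_1) (auto simp: mult_ac)
    then show ?thesis by (simp add: char_torus_add_axis)
  qed
  have sh2: "?g (x + axis i (1 - t)) = - ?g x" for x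
  proof -
    have "x + axis i (1 - t) = (x + axis i (- t)) + axis i 1"
      by (simp add: vec_eq_iff axis_def)
    then show ?thesis by (simp only: per sh1)
  qed
  have eqc: "(One :: real^'n) = 1" by (rule One_vec)
  have ax: "axis i 1 \<in> (Basis :: (real^'n) set)" by (simp add: axis_in_Basis_iff)
  define lo :: "real \<Rightarrow> real^'n" where "lo s = (\<chi> j. if j = i then s else (0::real))" for s
  define hi :: "real \<Rightarrow> real^'n" where "hi s = (\<chi> j. if j = i then s else (1::real))" for s
  have half: "?B \<inter> {x. x \<bullet> axis i 1 \<le> s} = cbox 0 (hi s)"
       "?B \<inter> {x. x \<bullet> axis i 1 \<ge> s} = cbox (lo s) 1" if "0 \<le> s" "s \<le> 1" for s
    using that interval_split_cart[where a=0 and b=1 and k=i and c=s]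
    by (simp_all add: eqc interval_cbox_cart cart_eq_inner_axis[symmetric] hi_def lo_def min_def max_def cong: if_cong)
  have intg: "?g integrable_on cbox a b" for a b
    by (intro integrable_continuous continuous_intros)
  have split: "integral ?B ?g = integral (cbox 0 (hi s)) ?g + integral (cbox (lo s) 1) ?g"
    if "0 \<le> s" "s \<le> 1" for s
    using integral_split[OF intg ax, of 0 One s] half[OF that] by simp
  have 1: "integral (cbox 0 (hi (1 - t))) ?g = - integral (cbox (lo t) 1) ?g"
  proof -
    have "((\<lambda>x. ?g (x + axis i (- t))) has_integral integral (cbox 0 (hi (1 - t))) ?g)
        (cbox (0 - axis i (- t)) (hi (1 - t) - axis i (- t)))"
      by (intro has_integral_translate_cbox integrable_integral intg)
    moreover have "0 - axis i (- t) = lo t" "hi (1 - t) - axis i (- t) = 1"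
      by (auto simp: vec_eq_iff axis_def lo_def hi_def)
    ultimately have "((\<lambda>x. - ?g x) has_integral integral (cbox 0 (hi (1 - t))) ?g) (cbox (lo t) 1)"
      by (simp add: sh1)
    then show ?thesis by (metis integral_unique integral_neg)
  qed
  have 2: "integral (cbox (lo (1 - t)) 1) ?g = - integral (cbox 0 (hi t)) ?g"
  proof -
    have "((\<lambda>x. ?g (x + axis i (1 - t))) has_integral integral (cbox (lo (1 - t)) 1) ?g)
        (cbox (lo (1 - t) - axis i (1 - t)) (1 - axis i (1 - t)))"
      by (intro has_integral_translate_cbox integrable_integral intg)
    moreover have "lo (1 - t) - axis i (1 - t) = 0" "1 - axis i (1 - t) = hi t"
      by (auto simp: vec_eq_iff axis_def lo_def hi_def)
    ultimately have "((\<lambda>x. - ?g x) has_integral integral (cbox (lo (1 - t)) 1) ?g) (cbox 0 (hi t))"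
      by (simp add: sh2)
    then show ?thesis by (metis integral_unique integral_neg)
  qed
  have "integral ?B ?g = - integral ?B ?g"
    using split[of t] split[of "1 - t"] t 1 2 by simp
  then show ?thesis by simp
qed

lemma content_unit_cube: "Henstock_Kurzweil_Integration.content (cbox 0 One :: (real^'n) set) = 1"
  by (simp add: content_cbox')

lemma integral_const_unit_cube: "integral (cbox 0 One :: (real^'n) set) (\<lambda>x. c) = (c :: 'a::euclidean_space)"
  by (simp add: content_unit_cube)

lemma coeff_eq_integral_block:
  assumes "\<xi> \<in> dyadic k"
  shows "c \<xi> = integral (cbox 0 One) (\<lambda>x. block c k x * cnj (char_torus \<xi> x))"
proof -
  have "integral (cbox 0 One) (\<lambda>x. block c k x * cnj (char_torus \<xi> x))
     = integral (cbox 0 One) (\<lambda>x. \<Sum>\<eta>\<in>dyadic k. c \<eta> * char_torus (\<eta> - \<xi>) x)"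
    unfolding block_char sum_distrib_right char_torus_mult_cnj[symmetric] by (simp only: mult_ac)
  also have "\<dots> = (\<Sum>\<eta>\<in>dyadic k. integral (cbox 0 One) (\<lambda>x. c \<eta> * char_torus (\<eta> - \<xi>) x))"
    by (intro integral_sum finite_dyadic integrable_continuous continuous_intros)
  also have "\<dots> = (\<Sum>\<eta>\<in>dyadic k. if \<eta> = \<xi> then c \<xi> else 0)"
    by (intro sum.cong) (auto simp: integral_char_torus_nonzero content_unit_cube)
  also have "\<dots> = c \<xi>" using assms by (simp add: sum.delta finite_dyadic)
  finally show ?thesis by simp
qed

section \<open>Norms of trigonometric polynomials\<close>

lemma powr_ge_tangent:
  fixes u p :: real
  assumes "p > 1" "u \<ge> 0"
  shows "1 + p * (u - 1) \<le> u powr p"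
proof -
  have "u * 1 \<le> u powr p / p + 1 powr (p / (p - 1)) / (p / (p - 1))"
    using assms by (intro Youngs_inequality) (auto simp: field_simps)
  also have "\<dots> = (u powr p + (p - 1)) / p" using assms by (simp add: add_divide_distrib)
  finally have "u * p \<le> u powr p + (p - 1)" using assms by (simp add: pos_le_divide_eq)
  then show ?thesis by (simp add: algebra_simps)
qed

lemma Lp_norm_torus_nonneg: "0 \<le> Lp_norm_torus p g"
  by (simp add: Lp_norm_torus_def)

lemma integrable_cmod_powr:
  assumes "continuous_on (cbox 0 One) g" "p > 0"
  shows "(\<lambda>x. cmod (g x) powr p) integrable_on cbox 0 (One :: real^'n)"
  using assms by (intro integrable_continuous continuous_on_powr' continuous_intros) auto

lemma integral_cmod_powr:
  assumes "p > 0" "continuous_on (cbox 0 One) g"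
  shows "integral (cbox 0 (One :: real^'n::finite)) (\<lambda>x. cmod (g x) powr p) = Lp_norm_torus p g powr p"
  using assms by (simp add: Lp_norm_torus_def powr_powr integral_nonneg integrable_cmod_powr)

lemma integral_cmod_le_Lp_norm_torus:
  fixes g :: "real^'n::finite \<Rightarrow> complex"
  assumes p: "p > 1" and g: "continuous_on (cbox 0 One) g"
  shows "integral (cbox 0 One) (\<lambda>x. cmod (g x)) \<le> Lp_norm_torus p g"
proof (rule dense_ge)
  fix e assume e: "Lp_norm_torus p g < e"
  then have e0: "e > 0" using Lp_norm_torus_nonneg[of p g] by linarith
  note intp = integrable_cmod_powr[OF g, of p]
  let ?c = "e powr (1 - p) / p"
  have "integral (cbox 0 One) (\<lambda>x. cmod (g x))
      \<le> integral (cbox 0 One) (\<lambda>x. e * (1 - 1 / p) + ?c * cmod (g x) powr p)"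
  proof (rule integral_le)
    show "(\<lambda>x. cmod (g x)) integrable_on cbox 0 One"
      using g by (intro integrable_continuous continuous_intros)
    show "(\<lambda>x. e * (1 - 1 / p) + ?c * cmod (g x) powr p) integrable_on cbox 0 One"
      using intp p by (intro integrable_add integrable_on_mult_right integrable_const) auto
    fix x
    have "1 + p * (cmod (g x) / e - 1) \<le> (cmod (g x) / e) powr p"
      using p e0 by (intro powr_ge_tangent) auto
    then have "e / p * (1 + p * (cmod (g x) / e - 1)) \<le> e / p * (cmod (g x) / e) powr p"
      using p e0 by (intro mult_left_mono) auto
    also have "e / p * (1 + p * (cmod (g x) / e - 1)) = cmod (g x) - e * (1 - 1 / p)"
      using p e0 by (simp add: field_simps)
    also have "e / p * (cmod (g x) / e) powr p = ?c * cmod (g x) powr p"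
      using p e0 by (simp add: powr_divide powr_diff)
    finally show "cmod (g x) \<le> e * (1 - 1 / p) + ?c * cmod (g x) powr p"
      by simp
  qed
  also have "\<dots> = e * (1 - 1 / p) + ?c * Lp_norm_torus p g powr p"
    using intp p
    by (subst integral_add) (auto simp: integral_const_unit_cube integral_cmod_powr[OF _ g] integrable_on_mult_right)
  also have "\<dots> \<le> e * (1 - 1 / p) + ?c * e powr p"
    using e p Lp_norm_torus_nonneg[of p g] by (intro add_left_mono mult_left_mono powr_mono2) auto
  also have "\<dots> = e" using p e0 by (simp add: powr_diff field_simps)
  finally show "integral (cbox 0 One) (\<lambda>x. cmod (g x)) \<le> e" .
qed

lemma Lp_norm_torus_le:
  fixes g :: "real^'n::finite \<Rightarrow> complex"
  assumes p: "p > 0" and g: "continuous_on (cbox 0 One) g"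
    and M: "\<And>x. cmod (g x) \<le> M"
  shows "Lp_norm_torus p g \<le> M"
proof -
  have M0: "0 \<le> M" using M[of 0] norm_ge_zero order_trans by blast
  have "integral (cbox 0 One) (\<lambda>x. cmod (g x) powr p) \<le> integral (cbox 0 (One::real^'n)) (\<lambda>x. M powr p)"
    using p M by (intro integral_le integrable_cmod_powr g powr_mono2 integrable_const) auto
  then have "Lp_norm_torus p g \<le> (M powr p) powr (1 / p)"
    unfolding Lp_norm_torus_def using p integral_const_unit_cube[of "M powr p", where 'n='n]
    by (intro powr_mono2 integral_nonneg integrable_cmod_powr g) auto
  also have "\<dots> = M" using p M0 by (simp add: powr_powr)
  finally show ?thesis .
qed

lemma powr_add_le:
  fixes x y s :: real
  assumes "x \<ge> 0" "y \<ge> 0" "s > 0"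
  shows "(x + y) powr s \<le> 2 powr s * (x powr s + y powr s)"
proof -
  have "(x + y) powr s \<le> (2 * max x y) powr s"
    using assms by (intro powr_mono2) auto
  also have "\<dots> = 2 powr s * (max x y) powr s" using assms by (simp add: powr_mult)
  also have "\<dots> \<le> 2 powr s * (x powr s + y powr s)"
    by (intro mult_left_mono) (auto simp: max_def)
  finally show ?thesis .
qed

lemma Lp_norm_torus_add_le:
  fixes f g :: "real^'n::finite \<Rightarrow> complex"
  assumes p: "p > 0" and f: "continuous_on (cbox 0 One) f" and g: "continuous_on (cbox 0 One) g"
  shows "Lp_norm_torus p (\<lambda>x. f x + g x) \<le> 2 * 2 powr (1 / p) * (Lp_norm_torus p f + Lp_norm_torus p g)"
proof -
  let ?I = "\<lambda>f. integral (cbox 0 (One::real^'n)) (\<lambda>x. cmod (f x) powr p)"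
  note int = integrable_cmod_powr[OF f p] integrable_cmod_powr[OF g p]
  have nn: "0 \<le> ?I f" "0 \<le> ?I g" by (auto intro!: integral_nonneg int)
  have "?I (\<lambda>x. f x + g x) \<le> integral (cbox 0 One) (\<lambda>x. 2 powr p * (cmod (f x) powr p + cmod (g x) powr p))"
  proof (rule integral_le)
    show "(\<lambda>x. cmod (f x + g x) powr p) integrable_on cbox 0 One"
      using f g p by (intro integrable_cmod_powr continuous_intros)
    show "(\<lambda>x. 2 powr p * (cmod (f x) powr p + cmod (g x) powr p)) integrable_on cbox 0 One"
      by (intro integrable_on_mult_right integrable_add int)
    fix x
    have "cmod (f x + g x) powr p \<le> (cmod (f x) + cmod (g x)) powr p"
      using p by (intro powr_mono2 norm_triangle_ineq) auto
    also have "\<dots> \<le> 2 powr p * (cmod (f x) powr p + cmod (g x) powr p)"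
      using p by (intro powr_add_le) auto
    finally show "cmod (f x + g x) powr p \<le> \<dots>" .
  qed
  also have "\<dots> = 2 powr p * (?I f + ?I g)"
    using int by (simp add: integral_add)
  finally have "Lp_norm_torus p (\<lambda>x. f x + g x) \<le> (2 powr p * (?I f + ?I g)) powr (1 / p)"
    unfolding Lp_norm_torus_def using p f g
    by (intro powr_mono2 integral_nonneg integrable_cmod_powr continuous_intros) auto
  also have "\<dots> = 2 * (?I f + ?I g) powr (1 / p)"
    using p nn by (simp add: powr_mult powr_powr)
  also have "\<dots> \<le> 2 * (2 powr (1 / p) * (?I f powr (1 / p) + ?I g powr (1 / p)))"
    using p nn by (intro mult_left_mono powr_add_le) auto
  finally show ?thesis by (simp add: Lp_norm_torus_def)
qed

lemma Lp_norm_torus_scale: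
  fixes g :: "real^'n::finite \<Rightarrow> complex"
  assumes p: "p > 0" and g: "continuous_on (cbox 0 One) g"
  shows "Lp_norm_torus p (\<lambda>x. z * g x) = cmod z * Lp_norm_torus p g"
  using p by (simp add: Lp_norm_torus_def norm_mult powr_mult integral_nonneg integrable_cmod_powr[OF g] powr_powr)

lemma coeff_le_Lp_norm_block:
  assumes "p > 1"
  shows "cmod (c \<xi>) \<le> Lp_norm_torus p (block c (level \<xi>))"
proof -
  have "\<xi> \<in> dyadic (level \<xi>)" by (simp add: mem_dyadic_iff)
  then have "cmod (c \<xi>) = cmod (integral (cbox 0 One) (\<lambda>x. block c (level \<xi>) x * cnj (char_torus \<xi> x)))"
    using coeff_eq_integral_block[of \<xi> _ c] by metis
  also have "\<dots> \<le> integral (cbox 0 One) (\<lambda>x. cmod (block c (level \<xi>) x))"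
    by (intro integral_norm_bound_integral integrable_continuous continuous_intros) (simp add: norm_mult)
  also have "\<dots> \<le> Lp_norm_torus p (block c (level \<xi>))"
    using assms by (intro integral_cmod_le_Lp_norm_torus continuous_intros)
  finally show ?thesis .
qed

lemma Lp_norm_block_le_sum:
  assumes "p > 0"
  shows "Lp_norm_torus p (block c k) \<le> (\<Sum>\<xi>\<in>dyadic k. cmod (c \<xi>))"
proof (rule Lp_norm_torus_le[OF assms])
  show "cmod (block c k x) \<le> (\<Sum>\<xi>\<in>dyadic k. cmod (c \<xi>))" for x
    unfolding block_char by (rule sum_norm_le) (simp add: norm_mult)
qed (intro continuous_intros)

lemma block_cong: "(\<And>\<xi>. level \<xi> = k \<Longrightarrow> c \<xi> = d \<xi>) \<Longrightarrow> block c k = block d k"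
  unfolding block_def by (intro ext sum.cong) (auto simp: mem_dyadic_iff)

lemma block_add: "block (\<lambda>\<xi>. c \<xi> + d \<xi>) k x = block c k x + block d k x"
  by (simp add: block_def distrib_left sum.distrib)

lemma block_scale: "block (\<lambda>\<xi>. z * c \<xi>) k x = z * block c k x"
  by (simp add: block_def sum_distrib_left mult_ac)

section \<open>Besov spaces\<close>

lemma besov_term_nonneg: "0 \<le> besov_term w p q c k"
  by (simp add: besov_term_def)

lemma besov_norm_nonneg: "0 \<le> besov_norm w p q c"
  by (simp add: besov_norm_def)

lemma besov_term_zero: "(\<And>\<xi>. level \<xi> = k \<Longrightarrow> c \<xi> = 0) \<Longrightarrow> besov_term w p q c k = 0"
  using block_cong[of k c "\<lambda>_. 0"]
  by (simp add: besov_term_def Lp_norm_torus_def block_def[of "\<lambda>_. 0"])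

lemma besov_term_cong: "(\<And>\<xi>. level \<xi> = k \<Longrightarrow> c \<xi> = d \<xi>) \<Longrightarrow> besov_term w p q c k = besov_term w p q d k"
  using block_cong[of k c d] by (simp add: besov_term_def)

lemma besov_space_summable: "c \<in> besov_space w p q \<Longrightarrow> summable (besov_term w p q c)"
  by (simp add: besov_space_def)

lemma besov_space_add:
  assumes p: "p > 0" and q: "q > 0" and c: "c \<in> besov_space w p q" and d: "d \<in> besov_space w p q"
  shows "(\<lambda>\<xi>. c \<xi> + d \<xi>) \<in> besov_space w p q"
proof -
  let ?K = "2 * 2 powr (1 / p)"
  have "besov_term w p q (\<lambda>\<xi>. c \<xi> + d \<xi>) k \<le> (?K powr q * 2 powr q) * (besov_term w p q c k + besov_term w p q d k)"
    for k
  proof -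
    let ?L = "\<lambda>c. Lp_norm_torus p (block c k)"
    have "?L (\<lambda>\<xi>. c \<xi> + d \<xi>) powr q \<le> (?K * (?L c + ?L d)) powr q"
      unfolding block_add[abs_def] using p q
      by (intro powr_mono2 Lp_norm_torus_add_le continuous_intros Lp_norm_torus_nonneg) auto
    also have "\<dots> = ?K powr q * (?L c + ?L d) powr q"
      by (simp add: powr_mult Lp_norm_torus_nonneg)
    also have "\<dots> \<le> ?K powr q * (2 powr q * (?L c powr q + ?L d powr q))"
      using q by (intro mult_left_mono powr_add_le Lp_norm_torus_nonneg) auto
    finally have "2 powr (real k * w * q) * ?L (\<lambda>\<xi>. c \<xi> + d \<xi>) powr q
      \<le> 2 powr (real k * w * q) * (?K powr q * (2 powr q * (?L c powr q + ?L d powr q)))"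
      by (rule mult_left_mono) simp
    then show ?thesis by (simp add: besov_term_def algebra_simps)
  qed
  note le = this
  have "summable (\<lambda>k. (?K powr q * 2 powr q) * (besov_term w p q c k + besov_term w p q d k))"
    using c d by (intro summable_mult summable_add besov_space_summable)
  then have "summable (besov_term w p q (\<lambda>\<xi>. c \<xi> + d \<xi>))"
    by (rule summable_comparison_test'[where N = 0]) (use le in \<open>simp add: besov_term_nonneg\<close>)
  then show ?thesis by (simp add: besov_space_def)
qed

lemma besov_space_scale:
  assumes p: "p > 0" and c: "c \<in> besov_space w p q"
  shows "(\<lambda>\<xi>. z * c \<xi>) \<in> besov_space w p q"
proof -
  have "besov_term w p q (\<lambda>\<xi>. z * c \<xi>) = (\<lambda>k. cmod z powr q * besov_term w p q c k)"
    using p by (auto simp: besov_term_def block_scale[abs_def] Lp_norm_torus_scale powr_mult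
        Lp_norm_torus_nonneg continuous_on_block)
  then show ?thesis using c by (simp add: besov_space_def summable_mult)
qed

lemma besov_space_zero: "(\<lambda>_ :: int^'n::finite. 0) \<in> besov_space w p q"
proof -
  have "besov_term w p q (\<lambda>_ :: int^'n. 0) = (\<lambda>_. 0)" by (auto intro: besov_term_zero)
  then show ?thesis by (simp add: besov_space_def)
qed

lemma besov_space_diff:
  assumes "p > 0" "q > 0" "c \<in> besov_space w p q" "d \<in> besov_space w p q"
  shows "(\<lambda>\<xi>. c \<xi> - d \<xi>) \<in> besov_space w p q"
  using besov_space_add[OF assms(1-3) besov_space_scale[OF assms(1,4), of "-1"]] by simp

lemma besov_space_sum:
  assumes "p > 0" "q > 0" "\<And>i. i \<in> I \<Longrightarrow> c i \<in> besov_space w p q"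
  shows "(\<lambda>\<xi>. \<Sum>i\<in>I. c i \<xi>) \<in> besov_space w p q"
  using assms(3)
  by (induction I rule: infinite_finite_induct) (auto intro: besov_space_zero besov_space_add assms)

definition delta :: "'a \<Rightarrow> 'a \<Rightarrow> complex" where
  "delta \<xi> \<eta> = (if \<eta> = \<xi> then 1 else 0)"

lemma sum_delta_support:
  assumes "finite A" "\<And>\<xi>. \<xi> \<notin> A \<Longrightarrow> c \<xi> = 0"
  shows "c = (\<lambda>\<eta>. \<Sum>\<xi>\<in>A. c \<xi> * delta \<xi> \<eta>)"
proof
  fix \<eta>
  have "(\<Sum>\<xi>\<in>A. c \<xi> * delta \<xi> \<eta>) = (\<Sum>\<xi>\<in>A. if \<xi> = \<eta> then c \<eta> else 0)"
    by (intro sum.cong) (auto simp: delta_def)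
  then show "c \<eta> = (\<Sum>\<xi>\<in>A. c \<xi> * delta \<xi> \<eta>)" using assms by simp
qed

lemma besov_space_finite_level:
  assumes "\<And>\<xi>. level \<xi> \<ge> N \<Longrightarrow> c \<xi> = 0"
  shows "c \<in> besov_space w p q"
proof -
  have "besov_term w p q c k = 0" if "k \<notin> {..<N}" for k
    using that assms by (intro besov_term_zero) auto
  then have "summable (besov_term w p q c)"
    by (intro summable_finite[of "{..<N}"]) auto
  then show ?thesis by (simp add: besov_space_def)
qed

lemma besov_space_finite_support:
  fixes A :: "(int^'n::finite) set"
  assumes "finite A" "\<And>\<xi>. \<xi> \<notin> A \<Longrightarrow> c \<xi> = 0"
  shows "c \<in> besov_space w p q"
proof (rule besov_space_finite_level)
  fix \<xi> :: "int^'n" assume "Suc (Max (level ` A)) \<le> level \<xi>"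
  then have "\<xi> \<notin> A" using assms(1) by (metis Max_ge finite_imageI image_eqI not_less_eq_eq)
  then show "c \<xi> = 0" by (rule assms)
qed

lemma delta_in_besov_space: "delta \<xi> \<in> besov_space w p q"
  by (rule besov_space_finite_support[of "{\<xi>}"]) (auto simp: delta_def)

lemma coeff_le_besov_norm:
  assumes p: "p > 1" and q: "q > 0" and c: "c \<in> besov_space w p q"
  shows "2 powr (real (level \<xi>) * w) * cmod (c \<xi>) \<le> besov_norm w p q c"
proof -
  let ?k = "level \<xi>"
  have "(2 powr (real ?k * w) * cmod (c \<xi>)) powr q \<le> besov_term w p q c ?k"
    unfolding besov_term_def powr_mult powr_powr using q p coeff_le_Lp_norm_block[OF p, of c \<xi>]
    by (simp add: powr_mult powr_powr powr_mono2)
  also have "\<dots> \<le> suminf (besov_term w p q c)"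
    using sum_le_suminf[OF besov_space_summable[OF c], of "{?k}"] by (simp add: besov_term_nonneg)
  finally have "((2 powr (real ?k * w) * cmod (c \<xi>)) powr q) powr (1 / q) \<le> besov_norm w p q c"
    unfolding besov_norm_def using q by (intro powr_mono2) auto
  then show ?thesis using q by (simp add: powr_powr)
qed

text \<open>Bound each block by its sup norm and use \<open>\<ell>\<^sup>1 \<subseteq> \<ell>\<^sup>q\<close>.\<close>

lemma besov_norm_le_infsum:
  assumes p: "p > 0" and q: "q \<ge> 1"
    and summ: "(\<lambda>\<xi>. 2 powr (real (level \<xi>) * w) * cmod (d \<xi>)) summable_on UNIV"
  shows "d \<in> besov_space w p q"
    and "besov_norm w p q d \<le> (\<Sum>\<^sub>\<infinity>\<xi>. 2 powr (real (level \<xi>) * w) * cmod (d \<xi>))"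
proof -
  let ?f = "\<lambda>\<xi>. 2 powr (real (level \<xi>) * w) * cmod (d \<xi>)"
  let ?s = "\<lambda>k. \<Sum>\<xi>\<in>dyadic k. ?f \<xi>"
  let ?S = "infsum ?f UNIV"
  have S0: "0 \<le> ?S" by (rule infsum_nonneg) simp
  have part: "sum ?f A \<le> ?S" if "finite A" for A
    using finite_sum_le_infsum[OF summ that] by simp
  have partial: "(\<Sum>k<N. ?s k) \<le> ?S" for N
  proof -
    have "(\<Sum>k<N. ?s k) = sum ?f (\<Union>k<N. dyadic k)"
      by (rule sum.UNION_disjoint[symmetric]) (auto simp: finite_dyadic mem_dyadic_iff)
    also have "\<dots> \<le> ?S" by (rule part) (simp add: finite_dyadic)
    finally show ?thesis .
  qed
  have term_le: "besov_term w p q d k \<le> ?S powr (q - 1) * ?s k" for k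
  proof -
    have s0: "0 \<le> ?s k" by (rule sum_nonneg) simp
    have sS: "?s k \<le> ?S" by (rule part) (rule finite_dyadic)
    have "?s k = 2 powr (real k * w) * (\<Sum>\<xi>\<in>dyadic k. cmod (d \<xi>))"
      unfolding sum_distrib_left by (rule sum.cong) (auto simp: mem_dyadic_iff)
    then have "2 powr (real k * w) * Lp_norm_torus p (block d k) \<le> ?s k"
      using Lp_norm_block_le_sum[OF p, of d k] by simp
    then have "(2 powr (real k * w) * Lp_norm_torus p (block d k)) powr q \<le> ?s k powr q"
      using q by (intro powr_mono2) (auto simp: Lp_norm_torus_nonneg)
    then have "besov_term w p q d k \<le> ?s k powr q"
      by (simp add: besov_term_def powr_mult powr_powr Lp_norm_torus_nonneg)
    also have "\<dots> = ?s k powr (q - 1) * ?s k"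
      using s0 powr_add[of "?s k" "q - 1" 1] by simp
    also have "\<dots> \<le> ?S powr (q - 1) * ?s k"
      using q s0 sS by (intro mult_right_mono powr_mono2) auto
    finally show ?thesis .
  qed
  have bound: "(\<Sum>k<N. besov_term w p q d k) \<le> ?S powr q" for N
  proof -
    have "(\<Sum>k<N. besov_term w p q d k) \<le> (\<Sum>k<N. ?S powr (q - 1) * ?s k)"
      by (rule sum_mono) (rule term_le)
    also have "\<dots> = ?S powr (q - 1) * (\<Sum>k<N. ?s k)" by (simp add: sum_distrib_left)
    also have "\<dots> \<le> ?S powr (q - 1) * ?S" by (intro mult_left_mono partial) simp
    also have "\<dots> = ?S powr q" using S0 powr_add[of ?S "q - 1" 1] by simp
    finally show ?thesis .
  qed
  have sm: "summable (besov_term w p q d)"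
    by (rule summableI_nonneg_bounded[OF besov_term_nonneg bound])
  then show "d \<in> besov_space w p q" by (simp add: besov_space_def)
  have "suminf (besov_term w p q d) \<le> ?S powr q"
    using suminf_le_const[OF sm bound] .
  then have "besov_norm w p q d \<le> (?S powr q) powr (1 / q)"
    unfolding besov_norm_def using q sm by (intro powr_mono2 suminf_nonneg besov_term_nonneg) auto
  then show "besov_norm w p q d \<le> ?S" using q S0 by (simp add: powr_powr)
qed

lemma besov_norm_delta_le:
  assumes "p > 0" "q \<ge> 1"
  shows "besov_norm w p q (delta \<xi>) \<le> 2 powr (real (level \<xi>) * w)"
proof -
  let ?f = "\<lambda>\<eta>. 2 powr (real (level \<eta>) * w) * cmod (delta \<xi> \<eta>)"
  have "(?f has_sum sum ?f {\<xi>}) {\<xi>}" by (rule has_sum_finite) simp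
  then have "(?f has_sum sum ?f {\<xi>}) UNIV"
    by (rule has_sum_cong_neutral[THEN iffD1, rotated -1]) (auto simp: delta_def)
  then have "?f summable_on UNIV" "infsum ?f UNIV = sum ?f {\<xi>}"
    by (auto simp: summable_on_def infsumI)
  then show ?thesis using besov_norm_le_infsum(2)[OF assms, of w "delta \<xi>"] by (simp add: delta_def)
qed

definition trunc :: "nat \<Rightarrow> (int^'n::finite \<Rightarrow> complex) \<Rightarrow> int^'n \<Rightarrow> complex" where
  "trunc N c \<xi> = (if level \<xi> < N then c \<xi> else 0)"

lemma trunc_in_besov_space: "trunc N c \<in> besov_space w p q"
  by (rule besov_space_finite_level[of N]) (auto simp: trunc_def)

lemma besov_norm_trunc_le:
  assumes "q > 0" "c \<in> besov_space w p q"
  shows "besov_norm w p q (trunc N c) \<le> besov_norm w p q c"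
proof -
  have "besov_term w p q (trunc N c) k \<le> besov_term w p q c k" for k
  proof (cases "k < N")
    case True
    then have "besov_term w p q (trunc N c) k = besov_term w p q c k"
      by (intro besov_term_cong) (auto simp: trunc_def)
    then show ?thesis by simp
  next
    case False
    then have "besov_term w p q (trunc N c) k = 0"
      by (intro besov_term_zero) (auto simp: trunc_def)
    then show ?thesis by (simp add: besov_term_nonneg)
  qed
  then have "suminf (besov_term w p q (trunc N c)) \<le> suminf (besov_term w p q c)"
    by (intro suminf_le besov_space_summable trunc_in_besov_space assms)
  then show ?thesis
    unfolding besov_norm_def using assms(1)
    by (intro powr_mono2 suminf_nonneg besov_space_summable trunc_in_besov_space besov_term_nonneg) auto
qed

lemma besov_norm_trunc_diff_tendsto:
  assumes q: "q > 0" and c: "c \<in> besov_space w p q"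
  shows "(\<lambda>N. besov_norm w p q (\<lambda>\<xi>. c \<xi> - trunc N c \<xi>)) \<longlonglongrightarrow> 0"
proof -
  have "suminf (besov_term w p q (\<lambda>\<xi>. c \<xi> - trunc N c \<xi>)) = (\<Sum>k. besov_term w p q c (k + N))" for N
  proof -
    let ?t = "besov_term w p q (\<lambda>\<xi>. c \<xi> - trunc N c \<xi>)"
    have lo: "?t k = 0" if "k < N" for k
      using that by (intro besov_term_zero) (auto simp: trunc_def)
    have hi: "?t (k + N) = besov_term w p q c (k + N)" for k
      by (intro besov_term_cong) (auto simp: trunc_def)
    have "summable ?t"
      using hi besov_space_summable[OF c] summable_iff_shift[of ?t N] summable_iff_shift[of "besov_term w p q c" N]
      by simp
    then have "suminf ?t = (\<Sum>k. ?t (k + N)) + (\<Sum>k<N. ?t k)" by (rule suminf_split_initial_segment)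
    then show ?thesis using lo hi by simp
  qed
  moreover have "(\<lambda>N. (\<Sum>k. besov_term w p q c (k + N)) powr (1 / q)) \<longlonglongrightarrow> 0 powr (1 / q)"
    using q by (intro tendsto_powr2 suminf_exist_split2 besov_space_summable[OF c] tendsto_const always_eventually allI suminf_nonneg)
      (auto simp: besov_term_nonneg intro!: summable_ignore_initial_segment besov_space_summable[OF c])
  ultimately show ?thesis using q by (simp add: besov_norm_def)
qed

section \<open>Dual norms\<close>

lemma
  assumes "besov_dual w p q \<phi>"
  shows dual_norm_nonneg: "0 \<le> dual_norm w p q \<phi>"
    and cmod_le_dual_norm: "c \<in> besov_space w p q \<Longrightarrow> cmod (\<phi> c) \<le> dual_norm w p q \<phi> * besov_norm w p q c"
proof -
  let ?A = "{K. 0 \<le> K \<and> (\<forall>c\<in>besov_space w p q. cmod (\<phi> c) \<le> K * besov_norm w p q c)}"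
  obtain K where K: "\<And>c. c \<in> besov_space w p q \<Longrightarrow> cmod (\<phi> c) \<le> K * besov_norm w p q c"
    using assms unfolding besov_dual_def by blast
  have "cmod (\<phi> c) \<le> max 0 K * besov_norm w p q c" if "c \<in> besov_space w p q" for c
    using K[OF that] mult_right_mono[of K "max 0 K" "besov_norm w p q c"] besov_norm_nonneg[of w p q c]
    by linarith
  then have ne: "?A \<noteq> {}" by (intro ex_in_conv[THEN iffD1] exI[of _ "max 0 K"]) auto
  then show "0 \<le> dual_norm w p q \<phi>" unfolding dual_norm_def by (rule cInf_greatest) auto
  show "cmod (\<phi> c) \<le> dual_norm w p q \<phi> * besov_norm w p q c" if c: "c \<in> besov_space w p q"
  proof (cases "besov_norm w p q c = 0")
    case True
    then show ?thesis using K[OF c] by simp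
  next
    case False
    then have pos: "besov_norm w p q c > 0" using besov_norm_nonneg[of w p q c] by simp
    have "cmod (\<phi> c) / besov_norm w p q c \<le> dual_norm w p q \<phi>"
      unfolding dual_norm_def using ne
      by (rule cInf_greatest) (use pos c in \<open>auto simp: divide_le_eq\<close>)
    then show ?thesis using pos by (simp add: divide_le_eq)
  qed
qed

lemma dual_norm_le:
  assumes "0 \<le> K" "\<And>c. c \<in> besov_space w p q \<Longrightarrow> cmod (\<phi> c) \<le> K * besov_norm w p q c"
  shows "dual_norm w p q \<phi> \<le> K"
  unfolding dual_norm_def by (rule cInf_lower) (use assms in \<open>auto intro: bdd_belowI[of _ 0]\<close>)

lemma besov_dual_add:
  "besov_dual w p q \<phi> \<Longrightarrow> c \<in> besov_space w p q \<Longrightarrow> d \<in> besov_space w p q \<Longrightarrow> \<phi> (\<lambda>\<xi>. c \<xi> + d \<xi>) = \<phi> c + \<phi> d"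
  unfolding besov_dual_def by blast

lemma besov_dual_scale:
  "besov_dual w p q \<phi> \<Longrightarrow> c \<in> besov_space w p q \<Longrightarrow> \<phi> (\<lambda>\<xi>. z * c \<xi>) = z * \<phi> c"
  unfolding besov_dual_def by blast

lemma besov_dual_diff:
  assumes "p > 0" "besov_dual w p q \<phi>" "c \<in> besov_space w p q" "d \<in> besov_space w p q"
  shows "\<phi> (\<lambda>\<xi>. c \<xi> - d \<xi>) = \<phi> c - \<phi> d"
  using besov_dual_add[OF assms(2,3) besov_space_scale[OF assms(1,4), of "-1"]]
    besov_dual_scale[OF assms(2,4), of "-1"] by simp

lemma besov_dual_sum:
  assumes "p > 0" "q > 0" "besov_dual w p q \<phi>" "finite I" "\<And>i. i \<in> I \<Longrightarrow> c i \<in> besov_space w p q"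
  shows "\<phi> (\<lambda>\<xi>. \<Sum>i\<in>I. z i * c i \<xi>) = (\<Sum>i\<in>I. z i * \<phi> (c i))"
  using assms(4,5)
proof (induction I)
  case empty
  show ?case using besov_dual_scale[OF assms(3) besov_space_zero, of 0] by simp
next
  case (insert i I)
  have "(\<lambda>\<xi>. \<Sum>i\<in>I. z i * c i \<xi>) \<in> besov_space w p q"
    using assms insert by (intro besov_space_sum besov_space_scale) auto
  then show ?case
    using insert besov_dual_add[OF assms(3) besov_space_scale[OF assms(1)]]
      besov_dual_scale[OF assms(3)] by simp
qed

section \<open>Summability over the lattice\<close>

lemma bracket_powr_summable_on_int:
  assumes e: "e < -1"
  shows "(\<lambda>j::int. sqrt (1 + (real_of_int j)\<^sup>2) powr e) summable_on UNIV"
proof -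
  let ?h = "\<lambda>j::int. sqrt (1 + (real_of_int j)\<^sup>2) powr e"
  have "summable (\<lambda>n. ?h (int n))"
  proof (rule summable_comparison_test'[where N = 1])
    show "summable (\<lambda>n. real n powr e)" using e by (simp add: summable_real_powr_iff)
    fix n :: nat assume n: "1 \<le> n"
    have "real n \<le> sqrt (1 + (real n)\<^sup>2)" by (rule real_le_rsqrt) simp
    then show "norm (?h (int n)) \<le> real n powr e"
      using n e by (simp add: powr_mono2')
  qed
  then have nat: "(\<lambda>n. ?h (int n)) summable_on UNIV"
    by (simp add: summable_on_UNIV_nonneg_real_iff)
  have pos: "?h summable_on range int"
    using nat by (subst summable_on_reindex) (auto simp: o_def)
  have "inj (\<lambda>n. - int n)" by (rule injI) simp
  then have neg: "?h summable_on range (\<lambda>n. - int n)"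
    using nat by (subst summable_on_reindex) (auto simp: o_def)
  have "(UNIV :: int set) = range int \<union> range (\<lambda>n. - int n)"
    by (auto intro: int_cases2)
  moreover have "?h summable_on range int \<union> range (\<lambda>n. - int n)"
    by (rule summable_on_union[OF pos neg])
  ultimately show ?thesis by simp
qed

lemma jbr_powr_summable_on:
  assumes s: "s < - real CARD('n)"
  shows "(\<lambda>\<xi> :: int^'n::finite. jbr \<xi> powr s) summable_on UNIV"
proof (rule nonneg_bdd_above_summable_on)
  define e where "e = s / real CARD('n)"
  have e: "e < -1" using s by (simp add: e_def pos_divide_less_eq)
  let ?h = "\<lambda>j::int. sqrt (1 + (real_of_int j)\<^sup>2) powr e"
  note hs = bracket_powr_summable_on_int[OF e]
  have le: "jbr \<xi> powr s \<le> (\<Prod>i\<in>UNIV. ?h (\<xi> $ i))" for \<xi> :: "int^'n"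
  proof -
    have "jbr \<xi> powr s = (jbr \<xi> powr e) ^ CARD('n)"
    proof -
      have "0 < jbr \<xi>" by (simp add: jbr_def add_pos_nonneg)
      then have "0 < jbr \<xi> powr e" by simp
      then have "(jbr \<xi> powr e) ^ CARD('n) = (jbr \<xi> powr e) powr real CARD('n)"
        by (rule powr_realpow[symmetric])
      then show ?thesis by (simp add: powr_powr e_def)
    qed
    also have "\<dots> = (\<Prod>i\<in>(UNIV::'n set). jbr \<xi> powr e)" by simp
    also have "\<dots> \<le> (\<Prod>i\<in>UNIV. ?h (\<xi> $ i))"
    proof (intro prod_mono conjI)
      fix i :: 'n
      have "(real_of_int (\<xi> $ i))\<^sup>2 \<le> (zn_norm \<xi>)\<^sup>2"
        using abs_component_le_zn_norm[of \<xi> i] by (metis abs_ge_zero power2_abs power_mono)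
      then have "sqrt (1 + (real_of_int (\<xi> $ i))\<^sup>2) \<le> jbr \<xi>" by (simp add: jbr_def)
      moreover have "0 < sqrt (1 + (real_of_int (\<xi> $ i))\<^sup>2)" by (simp add: add_pos_nonneg)
      ultimately show "jbr \<xi> powr e \<le> ?h (\<xi> $ i)" using e by (intro powr_mono2') auto
    qed simp
    finally show ?thesis .
  qed
  show "bdd_above (sum (\<lambda>\<xi> :: int^'n. jbr \<xi> powr s) ` {F. F \<subseteq> UNIV \<and> finite F})"
  proof (rule bdd_aboveI2)
    fix F :: "(int^'n) set" assume "F \<in> {F. F \<subseteq> UNIV \<and> finite F}"
    then have F: "finite F" by simp
    define B where "B i = (\<lambda>\<xi>. \<xi> $ i) ` F" for i
    have "(\<Sum>\<xi>\<in>F. jbr \<xi> powr s) \<le> (\<Sum>\<xi>\<in>F. \<Prod>i\<in>UNIV. ?h (\<xi> $ i))" by (rule sum_mono) (rule le)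
    also have "\<dots> = (\<Sum>g\<in>vec_nth ` F. \<Prod>i\<in>UNIV. ?h (g i))"
      by (subst sum.reindex) (auto simp: inj_on_def vec_nth_inject)
    also have "\<dots> \<le> (\<Sum>g\<in>PiE UNIV B. \<Prod>i\<in>UNIV. ?h (g i))"
      using F by (intro sum_mono2 finite_PiE) (auto simp: B_def intro!: prod_nonneg)
    also have "\<dots> = (\<Prod>i\<in>UNIV. \<Sum>j\<in>B i. ?h j)"
      using F by (intro prod_sum_PiE[symmetric]) (auto simp: B_def)
    also have "\<dots> \<le> (\<Prod>i\<in>(UNIV::'n set). infsum ?h UNIV)"
      using F by (intro prod_mono conjI sum_nonneg finite_sum_le_infsum[OF hs]) (auto simp: B_def)
    finally show "(\<Sum>\<xi>\<in>F. jbr \<xi> powr s) \<le> (\<Prod>i\<in>(UNIV::'n set). infsum ?h UNIV)" .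
  qed
qed simp

lemma finite_level_set_of_summable:
  fixes a :: "'a \<Rightarrow> complex"
  assumes "a summable_on UNIV" "\<mu> \<noteq> 0"
  shows "finite {\<xi>. a \<xi> = \<mu>}"
proof (rule ccontr)
  assume inf: "infinite {\<xi>. a \<xi> = \<mu>}"
  have summ: "(\<lambda>\<xi>. cmod (a \<xi>)) summable_on UNIV"
    using assms(1) summable_on_iff_abs_summable_on_complex by blast
  obtain n :: nat where n: "infsum (\<lambda>\<xi>. cmod (a \<xi>)) UNIV / cmod \<mu> < real n"
    using reals_Archimedean2 by blast
  obtain F where F: "F \<subseteq> {\<xi>. a \<xi> = \<mu>}" "finite F" "card F = n"
    using infinite_arbitrarily_large[OF inf] by blast
  have "real n * cmod \<mu> = (\<Sum>\<xi>\<in>F. cmod (a \<xi>))" using F by (simp add: subset_iff)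
  also have "\<dots> \<le> infsum (\<lambda>\<xi>. cmod (a \<xi>)) UNIV"
    using F by (intro finite_sum_le_infsum[OF summ]) auto
  finally show False using n assms(2) by (simp add: pos_divide_less_eq)
qed

lemma has_sum_by_values:
  fixes a :: "'a \<Rightarrow> complex"
  assumes a: "a summable_on UNIV"
  shows "((\<lambda>\<mu>. of_nat (card {\<xi>. a \<xi> = \<mu>}) * \<mu>) has_sum infsum a UNIV) {\<mu>. \<mu> \<noteq> 0 \<and> \<mu> \<in> range a}"
proof -
  let ?M = "{\<mu>. \<mu> \<noteq> 0 \<and> \<mu> \<in> range a}"
  let ?S = "Sigma ?M (\<lambda>\<mu>. {\<xi>. a \<xi> = \<mu>})"
  have "(a has_sum infsum a UNIV) UNIV" using a by simp
  then have "(a has_sum infsum a UNIV) {\<xi>. a \<xi> \<noteq> 0}"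
    by (rule has_sum_cong_neutral[THEN iffD1, rotated -1]) auto
  moreover have "bij_betw snd ?S {\<xi>. a \<xi> \<noteq> 0}"
    by (rule bij_betw_byWitness[where f' = "\<lambda>\<xi>. (a \<xi>, \<xi>)"]) auto
  ultimately have "((\<lambda>x. a (snd x)) has_sum infsum a UNIV) ?S"
    by (simp add: has_sum_reindex_bij_betw)
  then show ?thesis
  proof (rule has_sum_SigmaD)
    fix \<mu> assume "\<mu> \<in> ?M"
    then have "finite {\<xi>. a \<xi> = \<mu>}" by (intro finite_level_set_of_summable[OF a]) simp
    from has_sum_finite[OF this, of a]
    show "((\<lambda>y. a (snd (\<mu>, y))) has_sum of_nat (card {\<xi>. a \<xi> = \<mu>}) * \<mu>) {\<xi>. a \<xi> = \<mu>}"
      by simp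
  qed
qed

section \<open>Generalised eigenspaces of multipliers\<close>

interpretation fun_vs: vector_space "\<lambda>z (f :: 'a \<Rightarrow> complex) \<xi>. z * f \<xi>"
  by standard (auto simp: fun_eq_iff algebra_simps)

lemma sum_fun_eq: "(\<Sum>i\<in>A. f i) = (\<lambda>x. \<Sum>i\<in>A. f i x :: 'b :: comm_monoid_add)"
  by (induction A rule: infinite_finite_induct) (auto simp: fun_eq_iff)

lemma lin_indep_iff_independent:
  assumes "finite S"
  shows "lin_indep S \<longleftrightarrow> fun_vs.independent S"
  unfolding lin_indep_def fun_vs.dependent_finite[OF assms] sum_fun_eq zero_fun_def by blast

lemma inj_delta: "inj delta"
  by (rule injI) (metis delta_def zero_neq_one)

lemma lin_indep_delta:
  assumes "finite A"
  shows "lin_indep (delta ` A)"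
  unfolding lin_indep_def
proof (intro allI impI ballI)
  fix u s assume u: "(\<lambda>\<eta>. \<Sum>s\<in>delta ` A. u s * s \<eta>) = (\<lambda>_. 0)" and "s \<in> delta ` A"
  then obtain \<xi> where \<xi>: "\<xi> \<in> A" "s = delta \<xi>" by auto
  have "0 = (\<Sum>s\<in>delta ` A. u s * s \<xi>)" using u by (metis (mono_tags))
  also have "\<dots> = (\<Sum>\<zeta>\<in>A. u (delta \<zeta>) * delta \<zeta> \<xi>)"
    by (subst sum.reindex) (auto intro: inj_on_subset[OF inj_delta])
  also have "\<dots> = (\<Sum>\<zeta>\<in>A. if \<zeta> = \<xi> then u (delta \<xi>) else 0)"
    by (intro sum.cong) (auto simp: delta_def)
  also have "\<dots> = u s" using assms \<xi> by simp
  finally show "u s = 0" by simp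
qed

lemma card_le_of_lin_indep:
  assumes A: "finite A" and S: "finite S" "lin_indep S" and supp: "\<And>s \<xi>. s \<in> S \<Longrightarrow> \<xi> \<notin> A \<Longrightarrow> s \<xi> = 0"
  shows "card S \<le> card A"
proof -
  have "S \<subseteq> fun_vs.span (delta ` A)"
  proof
    fix s assume "s \<in> S"
    then have eq: "s = (\<Sum>\<xi>\<in>A. (\<lambda>\<eta>. s \<xi> * delta \<xi> \<eta>))"
      unfolding sum_fun_eq using supp by (intro sum_delta_support A) auto
    show "s \<in> fun_vs.span (delta ` A)"
      by (subst eq) (intro fun_vs.span_sum fun_vs.span_scale fun_vs.span_base imageI)
  qed
  then have "card S \<le> card (delta ` A)"
    using fun_vs.independent_span_bound[of "delta ` A" S] A S by (simp add: lin_indep_iff_independent)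
  also have "\<dots> \<le> card A" by (rule card_image_le[OF A])
  finally show ?thesis .
qed

lemma multiplier_shift_funpow:
  "((\<lambda>d \<xi>. multiplier a d \<xi> - \<mu> * d \<xi>) ^^ k) c = (\<lambda>\<xi>. (a \<xi> - \<mu>) ^ k * c \<xi>)"
  by (induction k) (auto simp: multiplier_def algebra_simps)

lemma gen_eigenspace_multiplier:
  "gen_eigenspace w p q (multiplier a) \<mu> = {c \<in> besov_space w p q. \<forall>\<xi>. a \<xi> \<noteq> \<mu> \<longrightarrow> c \<xi> = 0}"
proof -
  have "(\<exists>k. (\<lambda>\<xi>. (a \<xi> - \<mu>) ^ k * c \<xi>) = (\<lambda>_. 0)) \<longleftrightarrow> (\<forall>\<xi>. a \<xi> \<noteq> \<mu> \<longrightarrow> c \<xi> = 0)" for c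
  proof
    assume "\<forall>\<xi>. a \<xi> \<noteq> \<mu> \<longrightarrow> c \<xi> = 0"
    then have "(\<lambda>\<xi>. (a \<xi> - \<mu>) ^ 1 * c \<xi>) = (\<lambda>_. 0)" by (auto simp: fun_eq_iff)
    then show "\<exists>k. (\<lambda>\<xi>. (a \<xi> - \<mu>) ^ k * c \<xi>) = (\<lambda>_. 0)" ..
  qed (auto simp: fun_eq_iff)
  then show ?thesis unfolding gen_eigenspace_def multiplier_shift_funpow by simp
qed

lemma is_eigenvalue_multiplier: "is_eigenvalue w p q (multiplier a) \<mu> \<longleftrightarrow> \<mu> \<in> range a"
proof
  assume "is_eigenvalue w p q (multiplier a) \<mu>"
  then obtain c \<xi> where "multiplier a c = (\<lambda>\<xi>. \<mu> * c \<xi>)" "c \<xi> \<noteq> 0"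
    by (auto simp: is_eigenvalue_def fun_eq_iff)
  then have "a \<xi> = \<mu>" unfolding multiplier_def by (metis mult_right_cancel)
  then show "\<mu> \<in> range a" by blast
next
  assume "\<mu> \<in> range a"
  then obtain \<xi> where "\<mu> = a \<xi>" by blast
  then show "is_eigenvalue w p q (multiplier a) \<mu>"
    unfolding is_eigenvalue_def
    by (intro bexI[of _ "delta \<xi>"]) (auto simp: multiplier_def delta_def fun_eq_iff delta_in_besov_space)
qed

context
  fixes a :: "int^'n::finite \<Rightarrow> complex" and \<mu> :: complex
  assumes fin: "finite {\<xi>. a \<xi> = \<mu>}"
begin

lemma card_lin_indep_gen_eigenspace_le:
  assumes "finite S" "S \<subseteq> gen_eigenspace w p q (multiplier a) \<mu>" "lin_indep S"
  shows "card S \<le> card {\<xi>. a \<xi> = \<mu>}"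
  using assms by (intro card_le_of_lin_indep fin) (auto simp: gen_eigenspace_multiplier)

lemma fin_dim_gen_eig_multiplier: "fin_dim_gen_eig w p q (multiplier a) \<mu>"
  unfolding fin_dim_gen_eig_def using card_lin_indep_gen_eigenspace_le by blast

lemma alg_mult_multiplier: "alg_mult w p q (multiplier a) \<mu> = card {\<xi>. a \<xi> = \<mu>}"
  unfolding alg_mult_def
proof (rule cSup_eq_maximum)
  let ?A = "{\<xi>. a \<xi> = \<mu>}"
  have "delta ` ?A \<subseteq> gen_eigenspace w p q (multiplier a) \<mu>"
    by (auto simp: gen_eigenspace_multiplier delta_in_besov_space delta_def)
  moreover have "card (delta ` ?A) = card ?A"
    by (rule card_image) (rule inj_on_subset[OF inj_delta subset_UNIV])
  ultimately show "card ?A \<in> {card S |S. finite S \<and> S \<subseteq> gen_eigenspace w p q (multiplier a) \<mu> \<and> lin_indep S}"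
    using fin lin_indep_delta[OF fin] by (intro CollectI exI[of _ "delta ` ?A"]) auto
qed (auto intro: card_lin_indep_gen_eigenspace_le)

end

section \<open>Trace and nuclearity\<close>

lemma summable_of_summable_powr:
  fixes f :: "nat \<Rightarrow> real"
  assumes "r > 0" "r \<le> 1" "\<And>k. f k \<ge> 0" "summable (\<lambda>k. f k powr r)"
  shows "summable f"
proof -
  have "(\<lambda>k. f k powr r) \<longlonglongrightarrow> 0" by (rule summable_LIMSEQ_zero[OF assms(4)])
  then have "eventually (\<lambda>k. f k powr r < 1) sequentially" by (rule order_tendstoD) simp
  then have "eventually (\<lambda>k. norm (f k) \<le> f k powr r) sequentially"
  proof eventually_elim
    case (elim k)
    have "f k \<le> 1"
    proof (rule ccontr)
      assume "\<not> f k \<le> 1"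
      then have "1 powr r \<le> f k powr r" using assms by (intro powr_mono2) auto
      with elim show False by simp
    qed
    then have "f k powr 1 \<le> f k powr r"
      using assms by (intro powr_mono') auto
    then show ?case using assms by simp
  qed
  then show ?thesis by (rule summable_comparison_test_ev[OF _ assms(4)])
qed

lemma finite_level_less: "finite {\<xi> :: int^'n::finite. level \<xi> < N}"
proof -
  have "{\<xi> :: int^'n. level \<xi> < N} = (\<Union>k<N. dyadic k)" by (auto simp: mem_dyadic_iff)
  then show ?thesis by (simp add: finite_dyadic)
qed

lemma sum_level_less_tendsto:
  fixes a :: "int^'n::finite \<Rightarrow> complex"
  assumes "a summable_on UNIV"
  shows "(\<lambda>N. \<Sum>\<xi> | level \<xi> < N. a \<xi>) \<longlonglongrightarrow> infsum a UNIV"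
proof -
  have "(sum a \<longlongrightarrow> infsum a UNIV) (finite_subsets_at_top UNIV)"
    by (rule infsum_tendsto[OF assms])
  moreover have "filterlim (\<lambda>N. {\<xi> :: int^'n. level \<xi> < N}) (finite_subsets_at_top UNIV) sequentially"
    unfolding filterlim_finite_subsets_at_top
  proof (intro allI impI, elim conjE)
    fix X :: "(int^'n) set" assume "finite X"
    have "X \<subseteq> {\<xi>. level \<xi> < N}" if "N \<ge> Suc (Max (level ` X))" for N
    proof
      fix \<xi> assume "\<xi> \<in> X"
      then have "level \<xi> \<le> Max (level ` X)" using \<open>finite X\<close> by (intro Max_ge) auto
      then show "\<xi> \<in> {\<xi>. level \<xi> < N}" using that by simp
    qed
    then show "eventually (\<lambda>N. finite {\<xi> :: int^'n. level \<xi> < N} \<and> X \<subseteq> {\<xi>. level \<xi> < N} \<and> {\<xi>. level \<xi> < N} \<subseteq> UNIV) sequentially"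
      unfolding eventually_sequentially by (auto simp: finite_level_less)
  qed
  ultimately show ?thesis by (rule filterlim_compose)
qed

lemma trunc_eq_sum_delta: "trunc N c = (\<lambda>\<eta>. \<Sum>\<xi> | level \<xi> < N. c \<xi> * delta \<xi> \<eta>)"
  using sum_delta_support[OF finite_level_less[of N], of "trunc N c"] by (simp add: trunc_def)

lemma nuclear_rep_matrix_entry:
  assumes p: "p > 1" and q: "q > 0" and rep: "nuclear_rep w p q r T \<phi> y" and c: "c \<in> besov_space w p q"
  shows "(\<lambda>k. \<phi> k c * y k \<xi>) sums (T c \<xi>)"
proof -
  have y: "y k \<in> besov_space w p q" for k using rep by (simp add: nuclear_rep_def)
  have Tc: "T c \<in> besov_space w p q"
    and lim: "(\<lambda>N. besov_norm w p q (\<lambda>\<xi>. T c \<xi> - (\<Sum>k<N. \<phi> k c * y k \<xi>))) \<longlonglongrightarrow> 0"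
    using rep c by (auto simp: nuclear_rep_def)
  let ?W = "2 powr (real (level \<xi>) * w)"
  have le: "cmod (T c \<xi> - (\<Sum>k<N. \<phi> k c * y k \<xi>))
      \<le> besov_norm w p q (\<lambda>\<xi>. T c \<xi> - (\<Sum>k<N. \<phi> k c * y k \<xi>)) / ?W" for N
  proof -
    have "(\<lambda>\<xi>. T c \<xi> - (\<Sum>k<N. \<phi> k c * y k \<xi>)) \<in> besov_space w p q"
      using p q by (intro besov_space_diff besov_space_sum besov_space_scale y Tc) auto
    from coeff_le_besov_norm[OF p q this, of \<xi>] show ?thesis by (simp add: field_simps)
  qed
  have "(\<lambda>N. besov_norm w p q (\<lambda>\<xi>. T c \<xi> - (\<Sum>k<N. \<phi> k c * y k \<xi>)) / ?W) \<longlonglongrightarrow> 0"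
    using tendsto_divide[OF lim tendsto_const[of ?W]] by simp
  then have "(\<lambda>N. T c \<xi> - (\<Sum>k<N. \<phi> k c * y k \<xi>)) \<longlonglongrightarrow> 0"
    by (rule Lim_null_comparison[OF always_eventually[OF allI, OF le]])
  from tendsto_diff[OF tendsto_const[of "T c \<xi>"] this] show ?thesis by (simp add: sums_def)
qed

lemma nuclear_trace_multiplier:
  assumes p: "p > 1" and q: "q > 0" and r: "0 < r" "r \<le> 1" and a: "a summable_on UNIV"
    and rep: "nuclear_rep w p q r (multiplier a) \<phi> y"
  shows "(\<lambda>k. \<phi> k (y k)) sums infsum a UNIV"
proof -
  have dual: "besov_dual w p q (\<phi> k)" and y: "y k \<in> besov_space w p q" for k
    using rep by (auto simp: nuclear_rep_def)
  define M where "M k = dual_norm w p q (\<phi> k) * besov_norm w p q (y k)" for k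
  have M0: "0 \<le> M k" for k unfolding M_def
    by (intro mult_nonneg_nonneg dual_norm_nonneg dual besov_norm_nonneg)
  have "summable (\<lambda>k. M k powr r)"
    using rep by (simp add: nuclear_rep_def M_def powr_mult dual_norm_nonneg[OF dual] besov_norm_nonneg)
  then have M: "summable M" by (rule summable_of_summable_powr[OF r M0])
  have bound: "cmod (\<phi> k (trunc N (y k))) \<le> M k" for k N
  proof -
    have "cmod (\<phi> k (trunc N (y k))) \<le> dual_norm w p q (\<phi> k) * besov_norm w p q (trunc N (y k))"
      by (rule cmod_le_dual_norm[OF dual trunc_in_besov_space])
    also have "\<dots> \<le> M k" unfolding M_def
      by (intro mult_left_mono besov_norm_trunc_le q y dual_norm_nonneg dual)
    finally show ?thesis .
  qed
  have lim: "(\<lambda>N. \<phi> k (trunc N (y k))) \<longlonglongrightarrow> \<phi> k (y k)" for k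
  proof -
    let ?d = "\<lambda>N \<xi>. y k \<xi> - trunc N (y k) \<xi>"
    have le: "cmod (\<phi> k (y k) - \<phi> k (trunc N (y k))) \<le> dual_norm w p q (\<phi> k) * besov_norm w p q (?d N)" for N
    proof -
      have "?d N \<in> besov_space w p q"
        using p q by (intro besov_space_diff y trunc_in_besov_space) auto
      moreover have "\<phi> k (?d N) = \<phi> k (y k) - \<phi> k (trunc N (y k))"
        using p by (intro besov_dual_diff[OF _ dual y trunc_in_besov_space]) simp
      ultimately show ?thesis using cmod_le_dual_norm[OF dual] by metis
    qed
    have "(\<lambda>N. dual_norm w p q (\<phi> k) * besov_norm w p q (?d N)) \<longlonglongrightarrow> 0"
      by (intro tendsto_mult_right_zero besov_norm_trunc_diff_tendsto[OF q y])
    then have "(\<lambda>N. \<phi> k (y k) - \<phi> k (trunc N (y k))) \<longlonglongrightarrow> 0"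
      by (rule Lim_null_comparison[OF always_eventually[OF allI, OF le]])
    from tendsto_diff[OF tendsto_const[of "\<phi> k (y k)"] this] show ?thesis by simp
  qed
  have "eventually (\<lambda>N. summable (\<lambda>k. norm (\<phi> k (trunc N (y k))))) sequentially \<and>
      summable (\<lambda>k. norm (\<phi> k (y k))) \<and>
      (\<lambda>N. \<Sum>k. \<phi> k (trunc N (y k))) \<longlonglongrightarrow> (\<Sum>k. \<phi> k (y k))"
    by (rule tannerys_theorem[OF lim _ M]) (auto intro!: always_eventually bound)
  then have summ: "summable (\<lambda>k. \<phi> k (y k))"
    and conv: "(\<lambda>N. \<Sum>k. \<phi> k (trunc N (y k))) \<longlonglongrightarrow> (\<Sum>k. \<phi> k (y k))"
    by (auto intro: summable_norm_cancel)
  have "(\<Sum>k. \<phi> k (trunc N (y k))) = (\<Sum>\<xi> | level \<xi> < N. a \<xi>)" for N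
  proof -
    have "\<phi> k (trunc N (y k)) = (\<Sum>\<xi> | level \<xi> < N. \<phi> k (delta \<xi>) * y k \<xi>)" for k
      unfolding trunc_eq_sum_delta mult.commute[of "\<phi> k _"]
      using p q by (intro besov_dual_sum[OF _ _ dual] finite_level_less delta_in_besov_space) auto
    moreover have "(\<lambda>k. \<phi> k (delta \<xi>) * y k \<xi>) sums a \<xi>" for \<xi>
      using nuclear_rep_matrix_entry[OF p q rep delta_in_besov_space[of \<xi>], of \<xi>]
      by (simp add: multiplier_def delta_def)
    then have "(\<lambda>k. \<Sum>\<xi> | level \<xi> < N. \<phi> k (delta \<xi>) * y k \<xi>) sums (\<Sum>\<xi> | level \<xi> < N. a \<xi>)"
      by (intro sums_sum)
    ultimately show ?thesis by (simp add: sums_iff)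
  qed
  then have "(\<Sum>k. \<phi> k (y k)) = infsum a UNIV"
    using LIMSEQ_unique[OF conv] sum_level_less_tendsto[OF a] by simp
  then show ?thesis using summ by (simp add: sums_iff)
qed

lemma infinite_int_vec: "infinite (UNIV :: (int^'n::finite) set)"
proof
  assume "finite (UNIV :: (int^'n) set)"
  then have "finite (range (\<lambda>\<xi> :: int^'n. \<xi> $ undefined))" by (rule finite_imageI)
  moreover have "range (\<lambda>\<xi> :: int^'n. \<xi> $ undefined) = UNIV"
    by (rule surjI[where f = "\<lambda>j. \<chi> i. j"]) simp
  ultimately show False by (simp add: infinite_UNIV_int)
qed

lemma r_nuclear_multiplier:
  fixes a :: "int^'n::finite \<Rightarrow> complex"
  assumes p: "p > 1" and q: "q \<ge> 1" and a: "(\<lambda>\<xi>. cmod (a \<xi>)) summable_on UNIV"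
    and r: "r > 0" and ar: "(\<lambda>\<xi>. cmod (a \<xi>) powr r) summable_on UNIV"
  shows "r_nuclear w p q r (multiplier a)"
proof -
  define e where "e = from_nat_into (UNIV :: (int^'n) set)"
  have bij: "bij e"
    unfolding e_def by (rule bij_betw_from_nat_into[OF countableI_type infinite_int_vec])
  let ?W = "\<lambda>\<xi> :: int^'n. 2 powr (real (level \<xi>) * w)"
  have q0: "q > 0" and p0: "p > 0" using p q by auto
  define \<phi> where "\<phi> k c = a (e k) * c (e k)" for k and c :: "int^'n \<Rightarrow> complex"
  define y where "y k = delta (e k)" for k
  have \<phi>_bound: "cmod (\<phi> k c) \<le> cmod (a (e k)) / ?W (e k) * besov_norm w p q c" if "c \<in> besov_space w p q" for k c
  proof -
    have "cmod (a (e k)) * (?W (e k) * cmod (c (e k))) \<le> cmod (a (e k)) * besov_norm w p q c"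
      by (intro mult_left_mono coeff_le_besov_norm[OF p q0 that]) simp
    then show ?thesis by (simp add: \<phi>_def norm_mult field_simps)
  qed
  have dual: "besov_dual w p q (\<phi> k)" for k
    unfolding besov_dual_def
  proof (intro conjI)
    show "\<exists>K. \<forall>c\<in>besov_space w p q. cmod (\<phi> k c) \<le> K * besov_norm w p q c"
      using \<phi>_bound[of _ k] by blast
  qed (auto simp: \<phi>_def algebra_simps)
  have y: "y k \<in> besov_space w p q" for k by (simp add: y_def delta_in_besov_space)
  have term_le: "dual_norm w p q (\<phi> k) powr r * besov_norm w p q (y k) powr r \<le> cmod (a (e k)) powr r" for k
  proof -
    have "dual_norm w p q (\<phi> k) \<le> cmod (a (e k)) / ?W (e k)"
      by (rule dual_norm_le[OF _ \<phi>_bound]) simp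
    then have "dual_norm w p q (\<phi> k) * besov_norm w p q (y k) \<le> cmod (a (e k)) / ?W (e k) * ?W (e k)"
      unfolding y_def by (intro mult_mono besov_norm_delta_le p0 q besov_norm_nonneg) auto
    then have "dual_norm w p q (\<phi> k) * besov_norm w p q (y k) \<le> cmod (a (e k))" by simp
    then have "(dual_norm w p q (\<phi> k) * besov_norm w p q (y k)) powr r \<le> cmod (a (e k)) powr r"
      using r by (intro powr_mono2 mult_nonneg_nonneg dual_norm_nonneg dual besov_norm_nonneg) auto
    then show ?thesis by (simp add: powr_mult dual_norm_nonneg[OF dual] besov_norm_nonneg)
  qed
  have "summable (\<lambda>k. cmod (a (e k)) powr r)"
    using ar summable_on_reindex_bij_betw[OF bij, of "\<lambda>\<xi>. cmod (a \<xi>) powr r"]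
    by (simp add: summable_on_UNIV_nonneg_real_iff)
  then have summ: "summable (\<lambda>k. dual_norm w p q (\<phi> k) powr r * besov_norm w p q (y k) powr r)"
    by (rule summable_comparison_test'[where N = 0]) (use term_le in simp)
  have "multiplier a c \<in> besov_space w p q \<and>
      (\<lambda>N. besov_norm w p q (\<lambda>\<xi>. multiplier a c \<xi> - (\<Sum>k<N. \<phi> k c * y k \<xi>))) \<longlonglongrightarrow> 0"
    if c: "c \<in> besov_space w p q" for c
  proof -
    define g where "g \<xi> = ?W \<xi> * cmod (a \<xi> * c \<xi>)" for \<xi>
    have g_le: "g \<xi> \<le> cmod (a \<xi>) * besov_norm w p q c" for \<xi>
    proof -
      have "cmod (a \<xi>) * (?W \<xi> * cmod (c \<xi>)) \<le> cmod (a \<xi>) * besov_norm w p q c"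
        by (intro mult_left_mono coeff_le_besov_norm[OF p q0 c]) simp
      then show ?thesis by (simp add: g_def norm_mult mult_ac)
    qed
    have g: "g summable_on UNIV"
      by (rule summable_on_comparison_test[OF summable_on_cmult_left[OF a] g_le]) (simp add: g_def)
    have "multiplier a c \<in> besov_space w p q"
      using besov_norm_le_infsum(1)[OF p0 q, of w "multiplier a c"] g
      by (simp add: g_def[abs_def] multiplier_def)
    moreover have "(\<lambda>N. besov_norm w p q (\<lambda>\<xi>. multiplier a c \<xi> - (\<Sum>k<N. \<phi> k c * y k \<xi>))) \<longlonglongrightarrow> 0"
    proof -
      have le: "norm (besov_norm w p q (\<lambda>\<xi>. multiplier a c \<xi> - (\<Sum>k<N. \<phi> k c * y k \<xi>)))
          \<le> infsum g UNIV - (\<Sum>k<N. g (e k))" for N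
      proof -
        let ?F = "e ` {..<N}"
        have inj: "inj_on e {..<N}" using bij by (auto simp: bij_def intro: inj_on_subset)
        have sum_eq: "(\<Sum>k<N. \<phi> k c * y k \<xi>) = (if \<xi> \<in> ?F then a \<xi> * c \<xi> else 0)" for \<xi>
        proof -
          have "(\<Sum>k<N. \<phi> k c * y k \<xi>) = (\<Sum>\<eta>\<in>?F. if \<xi> = \<eta> then a \<xi> * c \<xi> else 0)"
            unfolding sum.reindex[OF inj] by (intro sum.cong) (auto simp: \<phi>_def y_def delta_def)
          then show ?thesis by simp
        qed
        let ?d = "\<lambda>\<xi>. multiplier a c \<xi> - (\<Sum>k<N. \<phi> k c * y k \<xi>)"
        have d: "(\<lambda>\<xi>. ?W \<xi> * cmod (?d \<xi>)) = (\<lambda>\<xi>. if \<xi> \<in> ?F then 0 else g \<xi>)"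
          unfolding sum_eq by (auto simp: multiplier_def g_def)
        have "(g has_sum infsum g UNIV - sum g ?F) (UNIV - ?F)"
          using g by (intro has_sum_Diff) auto
        then have "((\<lambda>\<xi>. if \<xi> \<in> ?F then 0 else g \<xi>) has_sum infsum g UNIV - sum g ?F) UNIV"
          by (rule has_sum_cong_neutral[THEN iffD1, rotated -1]) auto
        then have "(\<lambda>\<xi>. ?W \<xi> * cmod (?d \<xi>)) summable_on UNIV"
          and "infsum (\<lambda>\<xi>. ?W \<xi> * cmod (?d \<xi>)) UNIV = infsum g UNIV - sum g ?F"
          unfolding d by (auto simp: summable_on_def infsumI)
        then show ?thesis
          using besov_norm_le_infsum(2)[OF p0 q, of w ?d] sum.reindex[OF inj, of g]
          by (simp add: besov_norm_nonneg)
      qed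
      have "(\<lambda>N. infsum g UNIV - (\<Sum>k<N. g (e k))) \<longlonglongrightarrow> 0"
      proof -
        have "((\<lambda>k. g (e k)) has_sum infsum g UNIV) UNIV"
          using g by (simp add: has_sum_reindex_bij_betw[OF bij])
        then have "(\<lambda>N. \<Sum>k<N. g (e k)) \<longlonglongrightarrow> infsum g UNIV"
          using has_sum_imp_sums sums_def by blast
        from tendsto_diff[OF tendsto_const[of "infsum g UNIV"] this] show ?thesis by simp
      qed
      then show ?thesis
        by (rule Lim_null_comparison[OF always_eventually[OF allI, OF le]])
    qed
    ultimately show ?thesis by blast
  qed
  then have "nuclear_rep w p q r (multiplier a) \<phi> y"
    unfolding nuclear_rep_def using dual y summ by blast
  then show ?thesis unfolding r_nuclear_def by blast
qed

theorem theorem5p1: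
  fixes a :: "int^'n::finite \<Rightarrow> complex"
    and r \<alpha> C m p1 q1 :: real
  assumes r: "0 < r" "r \<le> 2/3"
    and \<alpha>: "0 < \<alpha>" "\<alpha> \<le> 1/2"
    and a_bound: "\<And>\<xi>. cmod (a \<xi>) \<le> C * (jbr \<xi>) powr m"
    and p1: "1 < p1" "p1 \<le> 2"
    and q1: "q1 = 1 / (\<alpha> + 1 / (p1 / (p1 - 1)))"
    and m: "m < - real CARD('n) / r - \<alpha> * real CARD('n)"
  shows "\<forall>w::real.
           r_nuclear w p1 q1 r (multiplier a) \<and>
           a summable_on UNIV \<and>
           (\<forall>\<phi> y. nuclear_rep w p1 q1 r (multiplier a) \<phi> y \<longrightarrow>
                  (\<lambda>k. \<phi> k (y k)) sums (infsum a UNIV)) \<and>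
           (\<forall>\<mu>. \<mu> \<noteq> 0 \<and> is_eigenvalue w p1 q1 (multiplier a) \<mu> \<longrightarrow>
                  fin_dim_gen_eig w p1 q1 (multiplier a) \<mu>) \<and>
           ((\<lambda>\<mu>. of_nat (alg_mult w p1 q1 (multiplier a) \<mu>) * \<mu>) has_sum (infsum a UNIV))
              {\<mu>. \<mu> \<noteq> 0 \<and> is_eigenvalue w p1 q1 (multiplier a) \<mu>}"
proof -
  have "0 < (p1 - 1) / p1" "(p1 - 1) / p1 \<le> 1 / 2" using p1 by (auto simp: field_simps)
  then have inv_q: "0 < \<alpha> + (p1 - 1) / p1" "\<alpha> + (p1 - 1) / p1 \<le> 1"
    using \<alpha> by linarith+
  have q: "1 \<le> q1" unfolding q1 using inv_q by simp
  have n: "real CARD('n) \<ge> 1" by (simp add: Suc_le_eq)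
  have "m < - real CARD('n) / r" using m \<alpha> n by (smt (verit) mult_nonneg_nonneg)
  then have mr: "m * r < - real CARD('n)" using r pos_less_divide_eq[of r m "- real CARD('n)"] by simp
  have "- real CARD('n) / r \<le> - real CARD('n)" using r n by (simp add: field_simps)
  then have m1: "m < - real CARD('n)" using \<open>m < - real CARD('n) / r\<close> by simp
  have C: "0 \<le> C"
  proof -
    have "0 \<le> C * jbr (0 :: int^'n) powr m" using a_bound[of 0] norm_ge_zero order_trans by blast
    then show ?thesis by (simp add: jbr_def zn_norm_def)
  qed
  have abs: "(\<lambda>\<xi>. cmod (a \<xi>)) summable_on UNIV"
    by (rule summable_on_comparison_test[OF summable_on_cmult_right[OF jbr_powr_summable_on[OF m1]]])
      (use a_bound in auto)
  have absr: "(\<lambda>\<xi>. cmod (a \<xi>) powr r) summable_on UNIV"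
  proof (rule summable_on_comparison_test[OF summable_on_cmult_right[OF jbr_powr_summable_on[OF mr]]])
    fix \<xi>
    have "cmod (a \<xi>) powr r \<le> (C * jbr \<xi> powr m) powr r"
      using r by (intro powr_mono2 a_bound) auto
    also have "\<dots> = C powr r * jbr \<xi> powr (m * r)" using C by (simp add: powr_mult powr_powr)
    finally show "cmod (a \<xi>) powr r \<le> C powr r * jbr \<xi> powr (m * r)" .
  qed simp
  have summ: "a summable_on UNIV" using abs abs_summable_summable by blast
  show ?thesis
  proof (intro allI conjI impI)
    fix w
    show "r_nuclear w p1 q1 r (multiplier a)"
      by (rule r_nuclear_multiplier[OF p1(1) q abs r(1) absr])
    show "a summable_on UNIV" by (rule summ)
    show "(\<lambda>k. \<phi> k (y k)) sums infsum a UNIV" if "nuclear_rep w p1 q1 r (multiplier a) \<phi> y" for \<phi> y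
      using r q by (intro nuclear_trace_multiplier[OF p1(1) _ r(1) _ summ that]) auto
    show "fin_dim_gen_eig w p1 q1 (multiplier a) \<mu>"
      if "\<mu> \<noteq> 0 \<and> is_eigenvalue w p1 q1 (multiplier a) \<mu>" for \<mu>
      using that by (intro fin_dim_gen_eig_multiplier finite_level_set_of_summable[OF summ]) simp
    have "alg_mult w p1 q1 (multiplier a) \<mu> = card {\<xi>. a \<xi> = \<mu>}" if "\<mu> \<noteq> 0" for \<mu>
      by (intro alg_mult_multiplier finite_level_set_of_summable[OF summ] that)
    then show "((\<lambda>\<mu>. of_nat (alg_mult w p1 q1 (multiplier a) \<mu>) * \<mu>) has_sum infsum a UNIV)
        {\<mu>. \<mu> \<noteq> 0 \<and> is_eigenvalue w p1 q1 (multiplier a) \<mu>}"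
      unfolding is_eigenvalue_multiplier using has_sum_by_values[OF summ]
      by (subst has_sum_cong[where g = "\<lambda>\<mu>. of_nat (card {\<xi>. a \<xi> = \<mu>}) * \<mu>"]) auto
  qed
qed

end
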